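(* Let $R$ be a commutative reduced ring with unity. The subgraph of $\mathbb{AG}(R)$ induced on the family of all $sz^\circ$-ideals belonging to $\mathbb{A}(R)^*$ is a retract of $\mathbb{AG}(R)$.
   Context: For $S\subseteq R$, $\mathrm{Ann}(S)=\{x\in R: Sx=\{0\}\}$. $\mathbb{A}(R)^*$ is the set of non-zero ideals $I$ of $R$ with $\mathrm{Ann}(I)\neq\{0\}$; the annihilating-ideal graph $\mathbb{AG}(R)$ has vertex set $\mathbb{A}(R)^*$, distinct $I,J$ being adjacent iff $IJ=\{0\}$. For $S\subseteq R$, $P_S$ is the intersection of all minimal prime ideals of $R$ containing $S$ (equal to $R$ if there are none). An ideal $I$ is an $sz^\circ$-ideal (strongly $z^\circ$-ideal) if $P_F\subseteq I$ for every finite subset $F$ of $I$. A graph homomorphism is a map of vertices sending adjacent vertices to adjacent vertices; a subgraph $H$ of $G$ is a retract of $G$ if there is a graph homomorphism $\varphi:G\to H$ with $\varphi(v)=v$ for every vertex $v$ of $H$. *)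

theory Defs
  imports "HOL-Algebra.Ideal_Product" "Graph_Theory.Pair_Digraph" "Graph_Theory.Digraph_Component"
begin

locale reduced_cring = cring +
  assumes nilpotent_eq_zero: "\<lbrakk>x \<in> carrier R; x [^] (n::nat) = \<zero>\<rbrakk> \<Longrightarrow> x = \<zero>"

definition annihilator :: "('a, 'b) ring_scheme \<Rightarrow> 'a set \<Rightarrow> 'a set" where
  "annihilator R S = {x \<in> carrier R. \<forall>s\<in>S. s \<otimes>\<^bsub>R\<^esub> x = \<zero>\<^bsub>R\<^esub>}"

definition minimal_prime_ideal :: "'a set \<Rightarrow> ('a, 'b) ring_scheme \<Rightarrow> bool" where
  "minimal_prime_ideal P R \<longleftrightarrow>
     primeideal P R \<and> (\<forall>Q. primeideal Q R \<and> Q \<subseteq> P \<longrightarrow> Q = P)"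

text \<open>The primes are minimal among all primes of \<open>R\<close>, not merely minimal over \<open>S\<close>.
  Intersecting with the carrier gives the value \<open>carrier R\<close> when no minimal prime contains \<open>S\<close>;
  otherwise it has no effect.\<close>

definition min_prime_hull :: "('a, 'b) ring_scheme \<Rightarrow> 'a set \<Rightarrow> 'a set" where
  "min_prime_hull R S = carrier R \<inter> \<Inter>{P. minimal_prime_ideal P R \<and> S \<subseteq> P}"

definition sz_circ_ideal :: "'a set \<Rightarrow> ('a, 'b) ring_scheme \<Rightarrow> bool" where
  "sz_circ_ideal I R \<longleftrightarrow> ideal I R \<and> (\<forall>F. finite F \<and> F \<subseteq> I \<longrightarrow> min_prime_hull R F \<subseteq> I)"

definition annihilating_ideals :: "('a, 'b) ring_scheme \<Rightarrow> 'a set set" where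
  "annihilating_ideals R =
     {I. ideal I R \<and> I \<noteq> {\<zero>\<^bsub>R\<^esub>} \<and> annihilator R I \<noteq> {\<zero>\<^bsub>R\<^esub>}}"

text \<open>Simple graphs, possibly infinite, are represented as loop-free symmetric digraphs.\<close>

definition annihilating_ideal_graph :: "('a, 'b) ring_scheme \<Rightarrow> 'a set pair_pre_digraph" where
  "annihilating_ideal_graph R =
     \<lparr> pverts = annihilating_ideals R,
       parcs = {(I, J). I \<in> annihilating_ideals R \<and> J \<in> annihilating_ideals R \<and>
                        I \<noteq> J \<and> I \<cdot>\<^bsub>R\<^esub> J = {\<zero>\<^bsub>R\<^esub>}} \<rparr>"

lemma (in cring) pair_bidirected_digraph_annihilating_ideal_graph:
  "pair_bidirected_digraph (annihilating_ideal_graph R)"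
proof
  show "symmetric (with_proj (annihilating_ideal_graph R))"
    unfolding symmetric_def
    by (auto simp: annihilating_ideal_graph_def annihilating_ideals_def sym_def ideal_prod_commute)
qed (auto simp: annihilating_ideal_graph_def)

definition graph_hom ::
  "('v, 'e) pre_digraph \<Rightarrow> ('w, 'f) pre_digraph \<Rightarrow> ('v \<Rightarrow> 'w) \<Rightarrow> bool" where
  "graph_hom G H \<phi> \<longleftrightarrow>
     (\<forall>v \<in> verts G. \<phi> v \<in> verts H) \<and> (\<forall>u v. u \<rightarrow>\<^bsub>G\<^esub> v \<longrightarrow> \<phi> u \<rightarrow>\<^bsub>H\<^esub> \<phi> v)"

definition graph_retract :: "('v, 'e) pre_digraph \<Rightarrow> ('v, 'e) pre_digraph \<Rightarrow> bool" where
  "graph_retract H G \<longleftrightarrow>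
     subgraph H G \<and> (\<exists>\<phi>. graph_hom G H \<phi> \<and> (\<forall>v \<in> verts H. \<phi> v = v))"

end

theory Submission
  imports Defs
begin

text \<open>
  The retraction sends an ideal \<open>I\<close> to the smallest \<open>sz\<^sup>\<circ>\<close>-ideal above it, the directed union of the
  hulls \<open>P\<^sub>F\<close> over the finite \<open>F \<subseteq> I\<close>. In a reduced ring the minimal primes intersect
  in zero; as a minimal prime containing \<open>F G = 0\<close> contains \<open>F\<close> or \<open>G\<close>, it follows that
  \<open>P\<^sub>F P\<^sub>G = 0\<close>. Hence passing to the closure preserves vanishing products, and it preserves
  distinctness of adjacent ideals because a common closure would have square zero.
\<close>

section \<open>Multiplicatively closed subsets\<close>

lemma primeideal_compl_submonoid:
  assumes "primeideal P R"
  shows "submonoid (carrier R - P) R"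
proof -
  interpret primeideal P R by fact
  show ?thesis
    using I_notcarr I_prime one_imp_carrier by unfold_locales auto
qed

text \<open>Adjoining the powers of \<open>a\<close> to \<open>S\<close> is the enlargement step
  against which a maximal multiplicative set is tested below.\<close>

lemma (in cring) submonoid_mult_powers:
  assumes "submonoid S R" "a \<in> carrier R"
  shows "submonoid {s \<otimes> a [^] (n::nat) | s n. s \<in> S} R"
proof -
  interpret S: submonoid S R by fact
  show ?thesis
  proof
    fix u v
    assume "u \<in> {s \<otimes> a [^] (n::nat) | s n. s \<in> S}" "v \<in> {s \<otimes> a [^] (n::nat) | s n. s \<in> S}"
    then obtain s t and m n :: nat
      where s: "s \<in> S" "u = s \<otimes> a [^] m" and t: "t \<in> S" "v = t \<otimes> a [^] n"
      by blast
    have "u \<otimes> v = (s \<otimes> t) \<otimes> a [^] (m + n)"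
      using s t assms(2) by (simp add: m_ac nat_pow_mult[symmetric])
    with s t show "u \<otimes> v \<in> {s \<otimes> a [^] (n::nat) | s n. s \<in> S}"
      by blast
  next
    have "\<one> = \<one> \<otimes> a [^] (0::nat)" by simp
    then show "\<one> \<in> {s \<otimes> a [^] (n::nat) | s n. s \<in> S}"
      using S.one_closed by blast
  qed (use assms in auto)
qed

section \<open>Minimal primes avoiding a non-zero element of a reduced ring\<close>

context reduced_cring
begin

lemma square_eq_zero:
  assumes "x \<in> carrier R" "x \<otimes> x = \<zero>"
  shows "x = \<zero>"
  using nilpotent_eq_zero[of x 2] assms by (simp add: numeral_2_eq_2)

text \<open>The power \<open>(s \<otimes> a) [^] Suc n\<close> has
  \<open>s \<otimes> a [^] n\<close> as a factor, so \<open>s \<otimes> a\<close> is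
  nilpotent.\<close>

lemma mult_pow_eq_zero:
  assumes "s \<in> carrier R" "a \<in> carrier R" "s \<otimes> a [^] (n::nat) = \<zero>"
  shows "s \<otimes> a = \<zero>"
proof (rule nilpotent_eq_zero[of _ "Suc n"])
  have "(s \<otimes> a) [^] Suc n = (s [^] n \<otimes> a) \<otimes> (s \<otimes> a [^] n)"
    using assms(1,2) by (simp add: nat_pow_distrib m_ac)
  then show "(s \<otimes> a) [^] Suc n = \<zero>"
    using assms by simp
qed (use assms in auto)

text \<open>The complement of a multiplicative set maximal among those containing \<open>x\<close> but not
  \<open>\<zero>\<close> is a minimal prime. This way a single use of Zorn's lemma suffices.\<close>

lemma minimal_prime_ideal_avoiding:
  assumes x: "x \<in> carrier R" "x \<noteq> \<zero>"
  obtains P where "minimal_prime_ideal P R" "x \<notin> P"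
proof -
  define \<A> where "\<A> = {S. submonoid S R \<and> x \<in> S \<and> \<zero> \<notin> S}"
  \<comment> \<open>The family is non-empty: it contains the set of powers of \<open>x\<close>, and
    none of these is zero because \<open>x\<close> is not nilpotent.\<close>
  have "{s \<otimes> x [^] (n::nat) | s n. s \<in> {\<one>}} \<in> \<A>"
  proof -
    have "submonoid {\<one>} R" by unfold_locales auto
    then have "submonoid {s \<otimes> x [^] (n::nat) | s n. s \<in> {\<one>}} R"
      using x(1) by (rule submonoid_mult_powers)
    moreover have "x \<in> {s \<otimes> x [^] (n::nat) | s n. s \<in> {\<one>}}"
      using x by (auto intro!: exI[of _ "1::nat"])
    moreover have "\<zero> \<notin> {s \<otimes> x [^] (n::nat) | s n. s \<in> {\<one>}}"
    proof
      assume "\<zero> \<in> {s \<otimes> x [^] (n::nat) | s n. s \<in> {\<one>}}"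
      then obtain n :: nat where "\<one> \<otimes> x [^] n = \<zero>" by force
      then show False
        using mult_pow_eq_zero[of \<one> x n] x by simp
    qed
    ultimately show ?thesis by (simp add: \<A>_def)
  qed
  moreover have "\<Union>\<C> \<in> \<A>" if "\<C> \<noteq> {}" "subset.chain \<A> \<C>" for \<C>
  proof -
    have sub: "\<And>S. S \<in> \<C> \<Longrightarrow> submonoid S R \<and> x \<in> S \<and> \<zero> \<notin> S"
      using that(2) by (auto simp: subset_chain_def \<A>_def)
    have "submonoid (\<Union>\<C>) R"
    proof
      show "\<Union>\<C> \<subseteq> carrier R"
        using sub submonoid.subset by blast
      show "\<one> \<in> \<Union>\<C>"
        using that(1) sub submonoid.one_closed by blast
      fix u v assume "u \<in> \<Union>\<C>" "v \<in> \<Union>\<C>"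
      then obtain S T where "S \<in> \<C>" "T \<in> \<C>" "u \<in> S" "v \<in> T" by blast
      moreover have "S \<subseteq> T \<or> T \<subseteq> S"
        using that(2) \<open>S \<in> \<C>\<close> \<open>T \<in> \<C>\<close> by (auto simp: subset_chain_def)
      ultimately obtain U where "U \<in> \<C>" "u \<in> U" "v \<in> U" by blast
      then show "u \<otimes> v \<in> \<Union>\<C>"
        using sub[of U] submonoid.m_closed[of U R u v] by blast
    qed
    with that(1) sub show ?thesis by (auto simp: \<A>_def)
  qed
  ultimately obtain S where S: "S \<in> \<A>" and max: "\<And>T. T \<in> \<A> \<Longrightarrow> S \<subseteq> T \<Longrightarrow> T = S"
    using subset_Zorn_nonempty[of \<A>] by blast
  then interpret S: submonoid S R by (simp add: \<A>_def)
  have "x \<in> S" "\<zero> \<notin> S" using S by (auto simp: \<A>_def)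
  \<comment> \<open>By maximality, adjoining the powers of an outside element \<open>a\<close> must
    produce zero, say \<open>s \<otimes> a [^] n = \<zero>\<close>; reducedness then removes the
    exponent.\<close>
  have kill: "\<exists>s\<in>S. s \<otimes> a = \<zero>" if "a \<in> carrier R" "a \<notin> S" for a
  proof -
    let ?T = "{s \<otimes> a [^] (n::nat) | s n. s \<in> S}"
    have "S \<subseteq> ?T"
    proof
      fix s assume "s \<in> S"
      then have "s = s \<otimes> a [^] (0::nat)" by simp
      with \<open>s \<in> S\<close> show "s \<in> ?T" by blast
    qed
    moreover have "a = \<one> \<otimes> a [^] (1::nat)" using that by simp
    then have "a \<in> ?T" using S.one_closed by blast
    ultimately have "?T \<notin> \<A>" using max that(2) by blast
    then have "\<zero> \<in> ?T"
      using submonoid_mult_powers[OF S.is_submonoid that(1)] \<open>S \<subseteq> ?T\<close> \<open>x \<in> S\<close>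
      unfolding \<A>_def by blast
    then obtain s n where "s \<in> S" "s \<otimes> a [^] (n::nat) = \<zero>" by auto
    then show ?thesis
      using mult_pow_eq_zero[of s a n] that(1) by auto
  qed
  \<comment> \<open>With this converse, the complement of \<open>S\<close> consists of exactly those
    ring elements killed by some element of \<open>S\<close>. The ideal laws are checked in this
    form.\<close>
  have notS: "a \<notin> S" if "s \<in> S" "s \<otimes> a = \<zero>" for s a
    using that S.m_closed \<open>\<zero> \<notin> S\<close> by metis
  define P where "P = carrier R - S"
  have killP: "a \<in> carrier R \<and> (\<exists>s\<in>S. s \<otimes> a = \<zero>)" if "a \<in> P" for a
    using that kill by (simp add: P_def)
  have "ideal P R"
  proof (rule idealI)
    show "ring R" ..
    show "subgroup P (add_monoid R)"
    proof (rule add.subgroupI)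
      fix a b assume "a \<in> P" "b \<in> P"
      then obtain s t where st: "s \<in> S" "s \<otimes> a = \<zero>" "t \<in> S" "t \<otimes> b = \<zero>"
        and ab: "a \<in> carrier R" "b \<in> carrier R"
        using killP by metis
      \<comment> \<open>The product of the two killers kills both summands and stays in
        \<open>S\<close>.\<close>
      have "(s \<otimes> t) \<otimes> (a \<oplus> b) = t \<otimes> (s \<otimes> a) \<oplus> s \<otimes> (t \<otimes> b)"
        using st(1,3) ab by (simp add: r_distr m_ac)
      also have "\<dots> = \<zero>" using st by simp
      finally show "a \<oplus> b \<in> P"
        using notS[of "s \<otimes> t"] st ab by (simp add: P_def)
    next
      fix a assume "a \<in> P"
      then obtain s where "s \<in> S" "s \<otimes> a = \<zero>" "a \<in> carrier R"
        using killP by metis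
      then have "s \<otimes> (\<ominus> a) = \<zero>" "\<ominus> a \<in> carrier R"
        by (auto simp: r_minus)
      with \<open>s \<in> S\<close> show "\<ominus> a \<in> P" using notS by (simp add: P_def)
    qed (use \<open>\<zero> \<notin> S\<close> in \<open>auto simp: P_def\<close>)
    fix a r assume "a \<in> P" and r: "r \<in> carrier R"
    then obtain s where s: "s \<in> S" "s \<otimes> a = \<zero>" "a \<in> carrier R"
      using killP by metis
    have "s \<otimes> (r \<otimes> a) = r \<otimes> (s \<otimes> a)"
      using s(1,3) r by (simp add: m_ac)
    then have "s \<otimes> (r \<otimes> a) = \<zero>" using s r by simp
    then show "r \<otimes> a \<in> P" using notS s r by (simp add: P_def)
    then show "a \<otimes> r \<in> P" using s r by (simp add: m_comm)
  qed
  then have "primeideal P R"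
    using cring_axioms
  proof (rule primeidealI)
    show "carrier R \<noteq> P"
      using x(1) \<open>x \<in> S\<close> unfolding P_def by blast
  qed (use S.m_closed in \<open>auto simp: P_def\<close>)
  \<comment> \<open>A smaller prime has a larger complement, again multiplicative, containing
    \<open>x\<close> and missing zero; maximality of \<open>S\<close> forces equality.\<close>
  moreover have "Q = P" if Q: "primeideal Q R" "Q \<subseteq> P" for Q
  proof -
    interpret Q: primeideal Q R by fact
    have "carrier R - Q \<in> \<A>" "S \<subseteq> carrier R - Q"
      using primeideal_compl_submonoid[OF Q(1)] Q(2) \<open>x \<in> S\<close> x(1) S.subset
      by (auto simp: \<A>_def P_def)
    then have "carrier R - Q = S" by (rule max)
    then show ?thesis using Q.a_subset by (auto simp: P_def)
  qed
  ultimately show ?thesis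
    using that[of P] \<open>x \<in> S\<close> by (auto simp: minimal_prime_ideal_def P_def)
qed

end

section \<open>Hulls as intersections of minimal primes\<close>

lemma min_prime_hull_superset:
  assumes "S \<subseteq> carrier R"
  shows "S \<subseteq> min_prime_hull R S"
  using assms by (auto simp: min_prime_hull_def)

text \<open>A minimal prime containing \<open>T\<close> contains the hull of \<open>T\<close>, hence
  \<open>S\<close>, so it takes part in the intersection for \<open>S\<close>.\<close>

lemma min_prime_hull_least:
  assumes "S \<subseteq> min_prime_hull R T"
  shows "min_prime_hull R S \<subseteq> min_prime_hull R T"
  using assms by (auto simp: min_prime_hull_def)

lemma min_prime_hull_mono:
  assumes "S \<subseteq> T"
  shows "min_prime_hull R S \<subseteq> min_prime_hull R T"
  using assms by (auto simp: min_prime_hull_def)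

lemma (in ring) min_prime_hull_ideal: "ideal (min_prime_hull R S) R"
proof -
  \<comment> \<open>Inserting the unit ideal keeps the intersected family non-empty and matches the
    intersection with the carrier in the definition.\<close>
  have "ideal (\<Inter>(insert (carrier R) {P. minimal_prime_ideal P R \<and> S \<subseteq> P})) R"
    by (rule i_Intersect)
      (auto simp: minimal_prime_ideal_def oneideal intro: primeideal.axioms(1))
  then show ?thesis by (simp add: min_prime_hull_def)
qed

lemma (in reduced_cring) min_prime_hull_mult_eq_zero:
  assumes F: "F \<subseteq> carrier R" and G: "G \<subseteq> carrier R"
    and FG: "\<And>f g. f \<in> F \<Longrightarrow> g \<in> G \<Longrightarrow> f \<otimes> g = \<zero>"
    and x: "x \<in> min_prime_hull R F" and y: "y \<in> min_prime_hull R G"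
  shows "x \<otimes> y = \<zero>"
proof (rule ccontr)
  assume "x \<otimes> y \<noteq> \<zero>"
  have xy: "x \<in> carrier R" "y \<in> carrier R"
    using x y by (auto simp: min_prime_hull_def)
  then obtain P where P: "minimal_prime_ideal P R" "x \<otimes> y \<notin> P"
    using minimal_prime_ideal_avoiding[of "x \<otimes> y"] \<open>x \<otimes> y \<noteq> \<zero>\<close> by auto
  then interpret primeideal P R by (simp add: minimal_prime_ideal_def)
  \<comment> \<open>If some \<open>f\<close> in \<open>F\<close> lies outside \<open>P\<close>, then
    \<open>f \<otimes> g = \<zero>\<close> puts every \<open>g\<close> in \<open>G\<close> into
    \<open>P\<close>. Either way \<open>P\<close> contains one of the two hulls.\<close>
  have "F \<subseteq> P \<or> G \<subseteq> P"
    using I_prime F G FG zero_closed by (metis subset_iff)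
  then have "x \<in> P \<or> y \<in> P"
    using x y P(1) by (auto simp: min_prime_hull_def)
  then show False
    using P(2) xy I_l_closed I_r_closed by blast
qed

section \<open>Closure to the smallest strongly z-circ ideal\<close>

definition sz_closure :: "('a, 'b) ring_scheme \<Rightarrow> 'a set \<Rightarrow> 'a set" where
  "sz_closure R I = (\<Union>F\<in>{F. finite F \<and> F \<subseteq> I}. min_prime_hull R F)"

lemma sz_closure_superset:
  assumes "I \<subseteq> carrier R"
  shows "I \<subseteq> sz_closure R I"
proof
  fix x assume "x \<in> I"
  then have "x \<in> min_prime_hull R {x}" "finite {x} \<and> {x} \<subseteq> I"
    using assms min_prime_hull_superset[of "{x}" R] by auto
  then show "x \<in> sz_closure R I" unfolding sz_closure_def by blast
qed

lemma sz_closure_eq: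
  assumes "sz_circ_ideal I R"
  shows "sz_closure R I = I"
proof
  show "sz_closure R I \<subseteq> I"
    using assms by (auto simp: sz_closure_def sz_circ_ideal_def)
  have "I \<subseteq> carrier R"
    using assms by (auto simp: sz_circ_ideal_def dest: ideal.Icarr)
  then show "I \<subseteq> sz_closure R I" by (rule sz_closure_superset)
qed

text \<open>This is directedness of the union: one finite witness is chosen for each element of
  \<open>G\<close>, and their finite union serves all of them.\<close>

lemma finite_subset_sz_closure:
  assumes "finite G" "G \<subseteq> sz_closure R I"
  obtains F where "finite F" "F \<subseteq> I" "G \<subseteq> min_prime_hull R F"
proof -
  have "\<forall>x\<in>G. \<exists>F. finite F \<and> F \<subseteq> I \<and> x \<in> min_prime_hull R F"
    using assms(2) by (auto simp: sz_closure_def)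
  then obtain h where h: "\<And>x. x \<in> G \<Longrightarrow> finite (h x) \<and> h x \<subseteq> I \<and> x \<in> min_prime_hull R (h x)"
    by metis
  show ?thesis
  proof (rule that[of "\<Union>(h ` G)"])
    show "G \<subseteq> min_prime_hull R (\<Union>(h ` G))"
    proof
      fix x assume "x \<in> G"
      then have "min_prime_hull R (h x) \<subseteq> min_prime_hull R (\<Union>(h ` G))"
        by (intro min_prime_hull_mono) blast
      with h \<open>x \<in> G\<close> show "x \<in> min_prime_hull R (\<Union>(h ` G))" by blast
    qed
  qed (use h assms(1) in auto)
qed

text \<open>Once \<open>G\<close> sits in a single hull, so does its own hull. This is the defining
  closure condition for the ideal \<open>sz_closure R I\<close>.\<close>

lemma min_prime_hull_subset_sz_closure:
  assumes "finite G" "G \<subseteq> sz_closure R I"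
  shows "min_prime_hull R G \<subseteq> sz_closure R I"
proof -
  obtain F where "finite F" "F \<subseteq> I" "G \<subseteq> min_prime_hull R F"
    using assms by (rule finite_subset_sz_closure)
  then show ?thesis
    using min_prime_hull_least[of G R F] by (auto simp: sz_closure_def)
qed

text \<open>Each ideal law involves at most two elements of the closure, and can be carried out in
  the hull of those elements, an ideal lying inside the closure.\<close>

lemma (in ring) sz_closure_ideal: "ideal (sz_closure R I) R"
proof (rule idealI)
  show "ring R" ..
  \<comment> \<open>The hull of the empty set, the intersection of all minimal primes, supplies
    zero.\<close>
  have "min_prime_hull R {} \<subseteq> sz_closure R I"
    by (rule min_prime_hull_subset_sz_closure) auto
  moreover have "\<zero> \<in> min_prime_hull R {}"
    using min_prime_hull_ideal by (simp add: additive_subgroup.zero_closed ideal.axioms(1))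
  ultimately have zero: "\<zero> \<in> sz_closure R I" by blast
  have hull: "ideal (min_prime_hull R G) R" "G \<subseteq> min_prime_hull R G"
    "min_prime_hull R G \<subseteq> sz_closure R I" if "finite G" "G \<subseteq> sz_closure R I" for G
  proof -
    have "G \<subseteq> carrier R" using that(2) by (auto simp: sz_closure_def min_prime_hull_def)
    then show "G \<subseteq> min_prime_hull R G" by (rule min_prime_hull_superset)
    show "min_prime_hull R G \<subseteq> sz_closure R I"
      using that by (rule min_prime_hull_subset_sz_closure)
  qed (rule min_prime_hull_ideal)
  show "subgroup (sz_closure R I) (add_monoid R)"
  proof (rule add.subgroupI)
    show "sz_closure R I \<subseteq> carrier R"
      by (auto simp: sz_closure_def min_prime_hull_def)
    show "sz_closure R I \<noteq> {}" using zero by blast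
  next
    fix a assume "a \<in> sz_closure R I"
    then have *: "finite {a}" "{a} \<subseteq> sz_closure R I" by auto
    interpret ideal "min_prime_hull R {a}" R by (rule hull(1)[OF *])
    show "\<ominus> a \<in> sz_closure R I" using hull(2,3)[OF *] by auto
  next
    fix a b assume "a \<in> sz_closure R I" "b \<in> sz_closure R I"
    then have *: "finite {a, b}" "{a, b} \<subseteq> sz_closure R I" by auto
    interpret ideal "min_prime_hull R {a, b}" R by (rule hull(1)[OF *])
    show "a \<oplus> b \<in> sz_closure R I" using hull(2,3)[OF *] by auto
  qed
  fix a r assume "a \<in> sz_closure R I" "r \<in> carrier R"
  then have *: "finite {a}" "{a} \<subseteq> sz_closure R I" by auto
  interpret ideal "min_prime_hull R {a}" R by (rule hull(1)[OF *])
  show "r \<otimes> a \<in> sz_closure R I" "a \<otimes> r \<in> sz_closure R I"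
    using hull(2,3)[OF *] I_l_closed[of a r] I_r_closed[of a r] \<open>r \<in> carrier R\<close> by auto
qed

lemma (in ring) sz_circ_ideal_sz_closure: "sz_circ_ideal (sz_closure R I) R"
  by (simp add: sz_circ_ideal_def sz_closure_ideal min_prime_hull_subset_sz_closure)

lemma (in reduced_cring) sz_closure_mult_eq_zero:
  assumes "I \<subseteq> carrier R" "J \<subseteq> carrier R"
    and "\<And>i j. i \<in> I \<Longrightarrow> j \<in> J \<Longrightarrow> i \<otimes> j = \<zero>"
    and "x \<in> sz_closure R I" "y \<in> sz_closure R J"
  shows "x \<otimes> y = \<zero>"
proof -
  obtain F G where F: "F \<subseteq> I" "x \<in> min_prime_hull R F"
    and G: "G \<subseteq> J" "y \<in> min_prime_hull R G"
    using assms(4,5) by (auto simp: sz_closure_def)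
  show ?thesis
  proof (rule min_prime_hull_mult_eq_zero[OF _ _ _ F(2) G(2)])
    show "F \<subseteq> carrier R" "G \<subseteq> carrier R" using F(1) G(1) assms(1,2) by auto
    show "f \<otimes> g = \<zero>" if "f \<in> F" "g \<in> G" for f g
      using that F(1) G(1) assms(3) by blast
  qed
qed

section \<open>The closure on vertices and edges of the annihilating-ideal graph\<close>

lemma (in ring) ideal_prod_eq_zero_iff:
  assumes "ideal I R" "ideal J R"
  shows "I \<cdot> J = {\<zero>} \<longleftrightarrow> (\<forall>i\<in>I. \<forall>j\<in>J. i \<otimes> j = \<zero>)"
proof
  assume *: "\<forall>i\<in>I. \<forall>j\<in>J. i \<otimes> j = \<zero>"
  \<comment> \<open>The ideal product is generated inductively from products by sums, and both rules
    preserve being zero.\<close>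
  have "s = \<zero>" if "s \<in> I \<cdot> J" for s
    using that by induction (use * in auto)
  then show "I \<cdot> J = {\<zero>}"
    using ideal_prod_is_ideal[OF assms] by (auto dest: ideal.axioms(1) additive_subgroup.zero_closed)
next
  assume "I \<cdot> J = {\<zero>}"
  then show "\<forall>i\<in>I. \<forall>j\<in>J. i \<otimes> j = \<zero>"
    using ideal_prod.prod[of _ I _ J R] by blast
qed

text \<open>A non-zero \<open>y\<close> annihilating \<open>I\<close> still annihilates the closure:
  vanishing products pass to the closures of \<open>I\<close> and \<open>{y}\<close>, and
  \<open>y\<close> lies in the latter.\<close>

lemma (in reduced_cring) sz_closure_annihilating:
  assumes "I \<in> annihilating_ideals R"
  shows "sz_closure R I \<in> annihilating_ideals R"
proof -
  interpret I: ideal I R using assms by (simp add: annihilating_ideals_def)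
  have IC: "I \<subseteq> sz_closure R I" using I.a_subset by (rule sz_closure_superset)
  \<comment> \<open>Since zero is a member, an annihilator different from \<open>{\<zero>}\<close>
    must have a non-zero element.\<close>
  have "\<zero> \<in> annihilator R I"
    using I.Icarr by (auto simp: annihilator_def)
  then obtain y where y: "y \<in> annihilator R I" "y \<noteq> \<zero>"
    using assms by (auto simp: annihilating_ideals_def)
  have "y \<in> annihilator R (sz_closure R I)"
  proof -
    have "y \<in> carrier R" using y by (simp add: annihilator_def)
    then have "y \<in> sz_closure R {y}" using sz_closure_superset[of "{y}" R] by auto
    with y I.a_subset sz_closure_mult_eq_zero[of I "{y}"] show ?thesis
      by (auto simp: annihilator_def)
  qed
  moreover have "sz_closure R I \<noteq> {\<zero>}"
    using assms IC I.zero_closed by (auto simp: annihilating_ideals_def)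
  ultimately show ?thesis
    using y(2) sz_closure_ideal by (auto simp: annihilating_ideals_def)
qed

lemma (in reduced_cring) sz_closure_adjacent:
  assumes "(I, J) \<in> parcs (annihilating_ideal_graph R)"
  shows "(sz_closure R I, sz_closure R J) \<in> parcs (annihilating_ideal_graph R)"
proof -
  have I: "I \<in> annihilating_ideals R" and J: "J \<in> annihilating_ideals R" and "I \<cdot> J = {\<zero>}"
    using assms by (auto simp: annihilating_ideal_graph_def)
  interpret I: ideal I R using I by (simp add: annihilating_ideals_def)
  interpret J: ideal J R using J by (simp add: annihilating_ideals_def)
  have "\<And>i j. i \<in> I \<Longrightarrow> j \<in> J \<Longrightarrow> i \<otimes> j = \<zero>"
    using ideal_prod_eq_zero_iff[OF I.is_ideal J.is_ideal] \<open>I \<cdot> J = {\<zero>}\<close> by blast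
  then have zero: "x \<otimes> y = \<zero>" if "x \<in> sz_closure R I" "y \<in> sz_closure R J" for x y
    using sz_closure_mult_eq_zero[OF I.a_subset J.a_subset] that by blast
  have "sz_closure R I \<noteq> sz_closure R J"
  proof
    assume "sz_closure R I = sz_closure R J"
    \<comment> \<open>Each \<open>x\<close> in \<open>I\<close> would lie in both closures, so
      \<open>x \<otimes> x = \<zero>\<close>, and reducedness gives zero. The vertex
      \<open>I\<close> would then be the zero ideal.\<close>
    then have "x = \<zero>" if "x \<in> I" for x
      using zero[of x x] square_eq_zero[of x] that sz_closure_superset[OF I.a_subset] I.Icarr by auto
    then have "I = {\<zero>}"
      using I.zero_closed by blast
    then show False
      using I by (simp add: annihilating_ideals_def)
  qed
  moreover have "sz_closure R I \<cdot> sz_closure R J = {\<zero>}"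
    using zero by (simp add: ideal_prod_eq_zero_iff sz_closure_ideal)
  ultimately show ?thesis
    using I J sz_closure_annihilating by (simp add: annihilating_ideal_graph_def)
qed

theorem proposition1p2:
  fixes R :: "('a, 'b) ring_scheme"
  assumes "reduced_cring R"
  shows "graph_retract
           (with_proj (annihilating_ideal_graph R) \<restriction> {I \<in> annihilating_ideals R. sz_circ_ideal I R})
           (with_proj (annihilating_ideal_graph R))"
proof -
  interpret reduced_cring R by fact
  interpret G: pair_bidirected_digraph "annihilating_ideal_graph R"
    by (rule pair_bidirected_digraph_annihilating_ideal_graph)
  let ?G = "with_proj (annihilating_ideal_graph R)"
  let ?S = "{I \<in> annihilating_ideals R. sz_circ_ideal I R}"
  have "?S \<subseteq> pverts (annihilating_ideal_graph R)" by (auto simp: annihilating_ideal_graph_def)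
  then have "subgraph (?G \<restriction> ?S) ?G"
    by (rule induced_imp_subgraph[OF G.induced_induce])
  moreover have "graph_hom ?G (?G \<restriction> ?S) (sz_closure R)"
    unfolding graph_hom_def
  proof (intro conjI ballI allI impI)
    fix I assume "I \<in> verts ?G"
    then show "sz_closure R I \<in> verts (?G \<restriction> ?S)"
      using sz_closure_annihilating sz_circ_ideal_sz_closure
      by (simp add: annihilating_ideal_graph_def)
  next
    fix I J assume "I \<rightarrow>\<^bsub>?G\<^esub> J"
    then have "(I, J) \<in> parcs (annihilating_ideal_graph R)" by simp
    moreover from this have "I \<in> annihilating_ideals R" "J \<in> annihilating_ideals R"
      by (auto simp: annihilating_ideal_graph_def)
    ultimately show "sz_closure R I \<rightarrow>\<^bsub>?G \<restriction> ?S\<^esub> sz_closure R J"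
      using sz_closure_adjacent sz_closure_annihilating sz_circ_ideal_sz_closure
      by (auto simp: arcs_ends_def arc_to_ends_def)
  qed
  moreover have "\<forall>I \<in> verts (?G \<restriction> ?S). sz_closure R I = I"
    by (simp add: sz_closure_eq)
  ultimately show ?thesis
    unfolding graph_retract_def by blast
qed

end
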